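(* Let $n \ge 1$, let $V \in M_n(\mathbb{C})$ be a partial isometry, and let $Q \in M_n(\mathbb{C})$ be a rank-one orthogonal projection. Then $$\mathrm{Tr}\,\bigl[Q\,|V - \mathrm{Tr}[QV]\, I_n|^4\bigr] \;\le\; \frac{4}{3}.$$ Moreover, if equality holds, then $|V|\,Q = Q\,|V|$.
   Context: $M_n(\mathbb{C})$ is the algebra of $n\times n$ complex matrices, $I_n$ is the identity matrix, and $\mathrm{Tr}$ is the usual trace. For $B \in M_n(\mathbb{C})$, $|B| = (B^*B)^{1/2}$. A matrix $V$ is a partial isometry if it is isometric on the orthogonal complement of its kernel; equivalently $V^*V$ is an orthogonal projection; equivalently $V = VV^*V$. *)

theory Defs
  imports
    "Jordan_Normal_Form.Schur_Decomposition"
    "Jordan_Normal_Form.Matrix_Kernel"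
    "Jordan_Normal_Form.DL_Rank"
begin

definition mat_trace :: "complex mat \<Rightarrow> complex" where
  "mat_trace A = (\<Sum>i<dim_row A. A $$ (i, i))"

definition cvec_norm :: "complex vec \<Rightarrow> real" where
  "cvec_norm v = sqrt (Re (v \<bullet>c v))"

definition partial_isometry :: "complex mat \<Rightarrow> bool" where
  "partial_isometry V \<longleftrightarrow>
    (\<forall>x \<in> carrier_vec (dim_col V).
      (\<forall>y \<in> mat_kernel V. x \<bullet>c y = 0) \<longrightarrow> cvec_norm (V *\<^sub>v x) = cvec_norm x)"

definition orthogonal_projection :: "complex mat \<Rightarrow> bool" where
  "orthogonal_projection P \<longleftrightarrow> square_mat P \<and> P * P = P \<and> mat_adjoint P = P"

text \<open>The order on \<^typ>\<open>complex\<close> is the one under which \<open>0 \<le> z\<close> means that \<open>z\<close> is real and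
  nonnegative; over the complex numbers the condition below forces \<open>A\<close> to be Hermitian.\<close>

definition pos_semidef :: "complex mat \<Rightarrow> bool" where
  "pos_semidef A \<longleftrightarrow>
    square_mat A \<and> (\<forall>v \<in> carrier_vec (dim_row A). 0 \<le> (A *\<^sub>v v) \<bullet>c v)"

definition pos_sqrt :: "complex mat \<Rightarrow> complex mat" where
  "pos_sqrt A = (THE B. B \<in> carrier_mat (dim_row A) (dim_row A) \<and> pos_semidef B \<and> B * B = A)"

definition mat_abs :: "complex mat \<Rightarrow> complex mat" where
  "mat_abs B = pos_sqrt (mat_adjoint B * B)"

end

theory Submission
  imports Defs
begin

text \<open>
  Write \<open>Q = u u\<^sup>*\<close> with a unit vector \<open>u\<close>, \<open>\<nu> = \<langle>V u, u\<rangle>\<close> and \<open>c = V u - \<nu> u\<close>, so that \<open>c\<close> is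
  orthogonal to \<open>u\<close> and the trace equals \<open>\<parallel>V\<^sup>* c - \<nu>\<^sup>* c\<parallel>\<^sup>2\<close>. With \<open>s = \<parallel>c\<parallel>\<^sup>2\<close> and \<open>t = |\<nu>|\<close> we have
  \<open>s + t\<^sup>2 = \<parallel>V u\<parallel>\<^sup>2 \<le> 1\<close> and \<open>\<langle>V\<^sup>* c, u\<rangle> = s\<close>. Hence the component of \<open>V\<^sup>* c\<close> orthogonal to \<open>u\<close> has squared
  norm at most \<open>s - s\<^sup>2\<close>, and Cauchy-Schwarz gives \<open>|\<langle>V\<^sup>* c, c\<rangle>| \<le> s r\<close> with \<open>r\<^sup>2 = 1 - s\<close>. The trace
  is therefore at most \<open>s (1 + t\<^sup>2 + 2 t r) \<le> s (1 + 3 r\<^sup>2) = 4/3 - 3 (s - 2/3)\<^sup>2\<close>, using \<open>t \<le> r\<close>.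
  Equality forces \<open>t = r\<close>, that is \<open>\<parallel>V u\<parallel> = 1\<close>, so \<open>u\<close> is fixed by the projection \<open>|V| = V\<^sup>* V\<close>.

  The facts about \<open>|B|\<close> rest on peeling off eigenvectors: a nonzero positive semidefinite matrix is
  \<open>M + l u u\<^sup>*\<close> with \<open>M\<close> positive semidefinite, \<open>M u = 0\<close> and \<open>l > 0\<close>, which yields an induction principle.
\<close>

section \<open>Inner product and adjoint\<close>

lemma dim_mat_adjoint [simp]:
  "dim_row (mat_adjoint A) = dim_col A" "dim_col (mat_adjoint A) = dim_row A"
  by (simp_all add: mat_adjoint_def)

lemma mat_adjoint_carrier [simp]:
  "A \<in> carrier_mat m n \<Longrightarrow> mat_adjoint A \<in> carrier_mat n m"
  by auto

lemma index_mat_adjoint [simp]: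
  "i < dim_col A \<Longrightarrow> j < dim_row A \<Longrightarrow> mat_adjoint A $$ (i, j) = conjugate (A $$ (j, i))"
  by (simp add: mat_adjoint_def mat_of_rows_index)

lemma mat_adjoint_mat_adjoint [simp]: "mat_adjoint (mat_adjoint (A :: complex mat)) = A"
  by (rule eq_matI) simp_all

lemma smult_zero_vec_right [simp]: "a \<cdot>\<^sub>v 0\<^sub>v n = (0\<^sub>v n :: complex vec)"
  by (intro eq_vecI) auto

lemma cscalar_prod_eq_sum: "dim_vec x = dim_vec y \<Longrightarrow> x \<bullet>c y = (\<Sum>i<dim_vec y. x $ i * cnj (y $ i))"
  by (simp add: scalar_prod_def lessThan_atLeast0)

lemma cscalar_prod_add_left:
  fixes x y z :: "complex vec"
  assumes "dim_vec x = dim_vec z" "dim_vec y = dim_vec z"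
  shows "(x + y) \<bullet>c z = x \<bullet>c z + y \<bullet>c z"
  using assms by (simp add: cscalar_prod_eq_sum distrib_right sum.distrib)

lemma cscalar_prod_minus_left:
  fixes x y z :: "complex vec"
  assumes "dim_vec x = dim_vec z" "dim_vec y = dim_vec z"
  shows "(x - y) \<bullet>c z = x \<bullet>c z - y \<bullet>c z"
  using assms by (simp add: cscalar_prod_eq_sum left_diff_distrib sum_subtractf)

lemma cscalar_prod_smult_left:
  fixes x z :: "complex vec"
  assumes "dim_vec x = dim_vec z"
  shows "(a \<cdot>\<^sub>v x) \<bullet>c z = a * (x \<bullet>c z)"
  using assms by (simp add: cscalar_prod_eq_sum sum_distrib_left mult.assoc)

lemma cscalar_prod_cnj:
  fixes x y :: "complex vec"
  assumes "dim_vec x = dim_vec y"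
  shows "cnj (x \<bullet>c y) = y \<bullet>c x"
  using assms by (simp add: cscalar_prod_eq_sum mult.commute)

lemma cscalar_prod_add_right:
  fixes x y z :: "complex vec"
  assumes "dim_vec x = dim_vec z" "dim_vec y = dim_vec z"
  shows "z \<bullet>c (x + y) = z \<bullet>c x + z \<bullet>c y"
  using assms by (simp add: cscalar_prod_eq_sum distrib_left sum.distrib)

lemma cscalar_prod_minus_right:
  fixes x y z :: "complex vec"
  assumes "dim_vec x = dim_vec z" "dim_vec y = dim_vec z"
  shows "z \<bullet>c (x - y) = z \<bullet>c x - z \<bullet>c y"
  using assms by (simp add: cscalar_prod_eq_sum right_diff_distrib sum_subtractf)

lemma cscalar_prod_smult_right:
  fixes x z :: "complex vec"
  assumes "dim_vec x = dim_vec z"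
  shows "z \<bullet>c (a \<cdot>\<^sub>v x) = cnj a * (z \<bullet>c x)"
  using assms by (simp add: cscalar_prod_eq_sum sum_distrib_left mult_ac)

lemmas cscalar_prod_linear =
  cscalar_prod_add_left cscalar_prod_minus_left cscalar_prod_smult_left
  cscalar_prod_add_right cscalar_prod_minus_right cscalar_prod_smult_right

lemma cscalar_prod_mat_adjoint:
  fixes A :: "complex mat"
  assumes "A \<in> carrier_mat m n" "x \<in> carrier_vec n" "y \<in> carrier_vec m"
  shows "(A *\<^sub>v x) \<bullet>c y = x \<bullet>c (mat_adjoint A *\<^sub>v y)"
proof -
  have "(A *\<^sub>v x) \<bullet>c y = (\<Sum>i<m. \<Sum>j<n. A $$ (i, j) * x $ j * cnj (y $ i))"
    using assms by (simp add: cscalar_prod_eq_sum scalar_prod_def lessThan_atLeast0 sum_distrib_right)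
  also have "\<dots> = (\<Sum>j<n. \<Sum>i<m. A $$ (i, j) * x $ j * cnj (y $ i))"
    by (rule sum.swap)
  also have "\<dots> = x \<bullet>c (mat_adjoint A *\<^sub>v y)"
    using assms by (simp add: cscalar_prod_eq_sum scalar_prod_def lessThan_atLeast0 sum_distrib_left mult_ac)
  finally show ?thesis .
qed

lemma cvec_norm_nonneg [simp]: "0 \<le> cvec_norm x"
  using conjugate_square_ge_0_vec[of x] by (simp add: cvec_norm_def less_eq_complex_def)

text \<open>The product is real and nonnegative, so the \<open>Re\<close> and \<open>sqrt\<close> in
  \<open>cvec_norm\<close> lose nothing. Norm identities can thus be expanded sesquilinearly over
  the complex numbers and then read off in the reals.\<close>

lemma cscalar_prod_self: "x \<bullet>c x = complex_of_real ((cvec_norm x)\<^sup>2)"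
proof -
  have "0 \<le> x \<bullet>c x" by auto
  then show ?thesis
    by (simp add: cvec_norm_def less_eq_complex_def complex_eq_iff)
qed

lemma cvec_norm_diff_square:
  assumes "dim_vec x = dim_vec y"
  shows "(cvec_norm (x - y))\<^sup>2 = (cvec_norm x)\<^sup>2 + (cvec_norm y)\<^sup>2 - 2 * Re (x \<bullet>c y)"
proof -
  have "complex_of_real ((cvec_norm (x - y))\<^sup>2) = complex_of_real ((cvec_norm x)\<^sup>2)
    + complex_of_real ((cvec_norm y)\<^sup>2) - (x \<bullet>c y + cnj (x \<bullet>c y))"
    unfolding cscalar_prod_self [symmetric]
    using assms by (simp add: cscalar_prod_linear cscalar_prod_cnj)
  then show ?thesis by (simp add: complex_eq_iff)
qed

lemma cvec_norm_smult_square: "(cvec_norm (a \<cdot>\<^sub>v x))\<^sup>2 = (cmod a)\<^sup>2 * (cvec_norm x)\<^sup>2"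
proof -
  have "complex_of_real ((cvec_norm (a \<cdot>\<^sub>v x))\<^sup>2) = (a * cnj a) * complex_of_real ((cvec_norm x)\<^sup>2)"
    unfolding cscalar_prod_self [symmetric]
    by (simp add: cscalar_prod_linear mult_ac)
  then show ?thesis
    unfolding complex_norm_square [symmetric] of_real_mult [symmetric] of_real_eq_iff .
qed

lemma cvec_norm_eq_0_iff: "x \<in> carrier_vec n \<Longrightarrow> cvec_norm x = 0 \<longleftrightarrow> x = 0\<^sub>v n"
  using conjugate_square_eq_0_vec[of x n] unfolding cscalar_prod_self by (metis of_real_eq_0_iff zero_eq_power2)

lemma cvec_norm_normalize:
  assumes "x \<in> carrier_vec n" "x \<noteq> 0\<^sub>v n"
  shows "cvec_norm (of_real (1 / cvec_norm x) \<cdot>\<^sub>v x) = 1"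
proof -
  have "cvec_norm x \<noteq> 0" using assms cvec_norm_eq_0_iff by blast
  then have "(cvec_norm (of_real (1 / cvec_norm x) \<cdot>\<^sub>v x))\<^sup>2 = 1"
    unfolding cvec_norm_smult_square by (simp add: norm_divide power_divide)
  moreover have "0 \<le> cvec_norm (of_real (1 / cvec_norm x) \<cdot>\<^sub>v x)" by (rule cvec_norm_nonneg)
  ultimately show ?thesis by (simp only: power2_eq_1_iff) linarith
qed

lemma cscalar_prod_Cauchy_Schwarz:
  assumes "x \<in> carrier_vec n" "y \<in> carrier_vec n"
  shows "(cmod (x \<bullet>c y))\<^sup>2 \<le> (cvec_norm x)\<^sup>2 * (cvec_norm y)\<^sup>2"
proof (cases "cvec_norm y = 0")
  case True
  then have "y = 0\<^sub>v n"
    using cvec_norm_eq_0_iff assms by blast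
  then have "x \<bullet>c y = 0"
    using assms by simp
  then show ?thesis by simp
next
  case False
  define a where "a = x \<bullet>c y"
  define N where "N = (cvec_norm y)\<^sup>2"
  have N: "N > 0" using False by (simp add: N_def)
  \<comment> \<open>The vector is \<open>x\<close> minus its orthogonal projection onto
    \<open>y\<close>.\<close>
  have "0 \<le> (cvec_norm (x - (a / of_real N) \<cdot>\<^sub>v y))\<^sup>2" by simp
  also have "\<dots> = (cvec_norm x)\<^sup>2 + (cmod (a / of_real N))\<^sup>2 * N - 2 * Re (cnj (a / of_real N) * a)"
    unfolding a_def N_def using assms
    by (subst cvec_norm_diff_square) (simp_all add: cvec_norm_smult_square cscalar_prod_smult_right)
  also have "(cmod (a / of_real N))\<^sup>2 = (cmod a)\<^sup>2 / N\<^sup>2"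
    by (simp add: norm_divide power_divide)
  also have "Re (cnj (a / of_real N) * a) = (cmod a)\<^sup>2 / N"
    unfolding cmod_power2 by (simp add: add_divide_distrib power2_eq_square)
  also have "(cvec_norm x)\<^sup>2 + (cmod a)\<^sup>2 / N\<^sup>2 * N - 2 * ((cmod a)\<^sup>2 / N) = (cvec_norm x)\<^sup>2 - (cmod a)\<^sup>2 / N"
    using N by (simp add: power2_eq_square)
  finally show ?thesis
    unfolding a_def [symmetric] N_def [symmetric] using N by (simp add: field_simps)
qed

section \<open>Positive semidefinite matrices\<close>

lemma mat_eq_if_mult_vec_eq:
  fixes A B :: "complex mat"
  assumes "A \<in> carrier_mat m n" "B \<in> carrier_mat m n"
    and "\<And>x. x \<in> carrier_vec n \<Longrightarrow> A *\<^sub>v x = B *\<^sub>v x"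
  shows "A = B"
proof (rule eq_matI)
  fix i j assume ij: "i < dim_row B" "j < dim_col B"
  have "(A *\<^sub>v unit_vec n j) $ i = (B *\<^sub>v unit_vec n j) $ i"
    using assms(3) by simp
  then show "A $$ (i, j) = B $$ (i, j)"
    using ij assms(1,2) by simp
qed (use assms in auto)

lemma cscalar_prod_unit_vec:
  fixes A :: "complex mat"
  assumes "A \<in> carrier_mat n n" "i < n" "j < n"
  shows "(A *\<^sub>v unit_vec n j) \<bullet>c unit_vec n i = A $$ (i, j)"
proof -
  have "conjugate (unit_vec n i) = (unit_vec n i :: complex vec)"
    by (rule eq_vecI) (auto simp: unit_vec_def)
  then show ?thesis using assms by simp
qed

lemma pos_semidefD:
  assumes "pos_semidef A" "A \<in> carrier_mat n n" "x \<in> carrier_vec n"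
  shows "0 \<le> (A *\<^sub>v x) \<bullet>c x"
  using assms by (auto simp: pos_semidef_def)

lemma pos_semidefI:
  assumes "A \<in> carrier_mat n n" "\<And>x. x \<in> carrier_vec n \<Longrightarrow> 0 \<le> (A *\<^sub>v x) \<bullet>c x"
  shows "pos_semidef A"
  using assms by (auto simp: pos_semidef_def)

text \<open>Polarization: positivity in the order on complex numbers makes the quadratic form real.
  Its values at \<open>unit_vec n i\<close> plus multiples of \<open>unit_vec n j\<close> then tie
  the entries at (i, j) and (j, i) together.\<close>

lemma pos_semidef_mat_adjoint:
  assumes psd: "pos_semidef A" and A: "A \<in> carrier_mat n n"
  shows "mat_adjoint A = A"
proof (rule eq_matI)
  fix i j assume ij: "i < dim_row A" "j < dim_col A"
  then have i: "i < n" and j: "j < n" using A by auto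
  have *: "Im (A $$ (i, i) + c * A $$ (i, j) + cnj c * A $$ (j, i) + c * cnj c * A $$ (j, j)) = 0" for c
  proof -
    define x where "x = unit_vec n i + c \<cdot>\<^sub>v unit_vec n j"
    have x: "x \<in> carrier_vec n" by (simp add: x_def)
    have "(A *\<^sub>v x) \<bullet>c x
      = A $$ (i, i) + c * A $$ (i, j) + cnj c * A $$ (j, i) + c * cnj c * A $$ (j, j)"
      using A i j unfolding x_def
      by (simp add: mult_add_distrib_mat_vec[OF A] mult_mat_vec[OF A] cscalar_prod_linear
          cscalar_prod_unit_vec[OF A] algebra_simps)
    with pos_semidefD[OF psd A x] show ?thesis by (simp add: less_eq_complex_def)
  qed
  have "Im (A $$ (i, i)) = 0" "Im (A $$ (j, j)) = 0"
    using pos_semidefD[OF psd A, of "unit_vec n i"] pos_semidefD[OF psd A, of "unit_vec n j"] A i j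
    by (simp_all add: cscalar_prod_unit_vec[OF A] less_eq_complex_def)
  \<comment> \<open>The choice 1 makes the imaginary parts of the two entries opposite; the choice
    \<i> makes their real parts equal.\<close>
  with *[of 1] *[of \<i>] have "A $$ (i, j) = cnj (A $$ (j, i))"
    by (simp add: complex_eq_iff)
  then show "mat_adjoint A $$ (i, j) = A $$ (i, j)" using A i j by simp
qed (use A in auto)

section \<open>Eigenvectors of Hermitian matrices\<close>

lemma hermitian_cscalar_prod:
  fixes A :: "complex mat"
  assumes "A \<in> carrier_mat n n" "mat_adjoint A = A" "x \<in> carrier_vec n" "y \<in> carrier_vec n"
  shows "(A *\<^sub>v x) \<bullet>c y = x \<bullet>c (A *\<^sub>v y)"
  using cscalar_prod_mat_adjoint[of A n n x y] assms by simp

text \<open>Schur triangularization turns \<open>A\<close> into an upper triangular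
  \<open>T\<close>. The first nonzero column of \<open>T\<close> is an eigenvector of
  \<open>T\<close>, and \<open>P\<close> carries it to an eigenvector of \<open>A\<close>. Hermitian
  symmetry then excludes the eigenvalue 0.\<close>

lemma hermitian_eigenvector_exists:
  fixes A :: "complex mat"
  assumes A: "A \<in> carrier_mat n n" and herm: "mat_adjoint A = A" and nz: "A \<noteq> 0\<^sub>m n n"
  shows "\<exists>\<mu> x. \<mu> \<noteq> 0 \<and> x \<in> carrier_vec n \<and> x \<noteq> 0\<^sub>v n \<and> A *\<^sub>v x = \<mu> \<cdot>\<^sub>v x"
proof -
  obtain es where es: "char_poly A = (\<Prod>e\<leftarrow>es. [:- e, 1:])"
    using char_poly_factorized[OF A] by blast
  obtain T P P' where "schur_decomposition A es = (T, P, P')"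
    by (metis prod_cases3)
  from schur_decomposition[OF A es this]
  have sim: "similar_mat_wit A T P P'" and ut: "upper_triangular T" by auto
  note w = similar_mat_witD2[OF A sim]
  have "T \<noteq> 0\<^sub>m n n"
    using w(3,6,7) nz by auto
  then have ex: "\<exists>j. j < n \<and> col T j \<noteq> 0\<^sub>v n"
  proof (rule contrapos_np)
    assume *: "\<nexists>j. j < n \<and> col T j \<noteq> 0\<^sub>v n"
    have "T $$ (i, j) = 0" if "i < n" "j < n" for i j
      using * that w(5) by (metis carrier_matD index_col index_zero_vec(1))
    then show "T = 0\<^sub>m n n" using w(5) by (intro eq_matI) auto
  qed
  define j where "j = (LEAST j. j < n \<and> col T j \<noteq> 0\<^sub>v n)"
  have j: "j < n" "col T j \<noteq> 0\<^sub>v n"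
    using LeastI_ex[OF ex] by (simp_all add: j_def)
  have least: "col T k = 0\<^sub>v n" if "k < j" for k
    using not_less_Least[OF that[unfolded j_def]] that j(1) by simp
  define z where "z = col T j"
  have z: "z \<in> carrier_vec n" unfolding z_def using w(5) col_dim[of T j] by auto
  \<comment> \<open>The columns before the first nonzero column \<open>z\<close> vanish, and \<open>z\<close> has no entry below
    position \<open>j\<close>, so only the \<open>j\<close>-th column of \<open>T\<close> contributes to \<open>T z\<close>.\<close>
  have Tz: "T *\<^sub>v z = T $$ (j, j) \<cdot>\<^sub>v z"
  proof (rule eq_vecI)
    fix i assume "i < dim_vec (T $$ (j, j) \<cdot>\<^sub>v z)"
    then have i: "i < n" using z by simp
    have "(T *\<^sub>v z) $ i = (\<Sum>k<n. T $$ (i, k) * T $$ (k, j))"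
      using w(5) i j by (simp add: z_def scalar_prod_def lessThan_atLeast0)
    also have "\<dots> = (\<Sum>k<n. if k = j then T $$ (i, j) * T $$ (j, j) else 0)"
    proof (rule sum.cong[OF refl])
      fix k assume "k \<in> {..<n}"
      then have k: "k < n" by simp
      consider "k < j" | "k = j" | "j < k" by linarith
      then show "T $$ (i, k) * T $$ (k, j) = (if k = j then T $$ (i, j) * T $$ (j, j) else 0)"
      proof cases
        case 1
        have "col T k $ i = 0" using least[OF 1] i by simp
        with 1 i k w(5) show ?thesis by simp
      next
        case 3
        with ut k w(5) have "T $$ (k, j) = 0" by (auto simp: upper_triangular_def)
        with 3 show ?thesis by simp
      qed simp
    qed
    also have "\<dots> = (T $$ (j, j) \<cdot>\<^sub>v z) $ i"
      using i j w(5) by (simp add: z_def)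
    finally show "(T *\<^sub>v z) $ i = (T $$ (j, j) \<cdot>\<^sub>v z) $ i" .
  qed (use w(5) z in simp)
  have P'P: "P' *\<^sub>v (P *\<^sub>v x) = x" if "x \<in> carrier_vec n" for x
    using assoc_mult_mat_vec[OF w(7,6) that] w(2) that by simp
  have A_P: "A *\<^sub>v (P *\<^sub>v x) = P *\<^sub>v (T *\<^sub>v x)" if x: "x \<in> carrier_vec n" for x
  proof -
    have "A *\<^sub>v (P *\<^sub>v x) = P *\<^sub>v (T *\<^sub>v (P' *\<^sub>v (P *\<^sub>v x)))"
      unfolding w(3) using w(5-7) x by (simp add: assoc_mult_mat_vec[of _ n n _ n] mult_carrier_mat[of _ n n] del: assoc_mult_mat)
    then show ?thesis using P'P[OF x] by simp
  qed
  define y where "y = P *\<^sub>v z"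
  have y: "y \<in> carrier_vec n" using w z by (simp add: y_def)
  have "P' *\<^sub>v y = z"
    unfolding y_def by (rule P'P[OF z])
  moreover have "P' *\<^sub>v 0\<^sub>v n = 0\<^sub>v n" using w(7) by auto
  ultimately have y0: "y \<noteq> 0\<^sub>v n"
    using j(2) by (auto simp: z_def)
  have Ay: "A *\<^sub>v y = T $$ (j, j) \<cdot>\<^sub>v y"
    unfolding y_def using A_P[OF z] Tz mult_mat_vec[OF w(6) z] by simp
  \<comment> \<open>A preimage of \<open>y\<close> under \<open>A\<close>: if \<open>A\<close>
    killed \<open>y\<close>, then \<open>y \<bullet>c y\<close> would equal the product of
    \<open>e\<close> with \<open>A *\<^sub>v y\<close>, which is 0.\<close>
  define e where "e = P *\<^sub>v unit_vec n j"
  have e: "e \<in> carrier_vec n" using w by (simp add: e_def)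
  have "T *\<^sub>v unit_vec n j = z"
    unfolding z_def using w(5) j(1) by (intro eq_vecI) auto
  then have Ae: "A *\<^sub>v e = y"
    using A_P[of "unit_vec n j"] by (simp add: e_def y_def)
  have "T $$ (j, j) \<noteq> 0"
  proof
    assume "T $$ (j, j) = 0"
    with Ay y have "A *\<^sub>v y = 0\<^sub>v n" by (intro eq_vecI) auto
    then have "y \<bullet>c y = 0"
      using hermitian_cscalar_prod[OF A herm e y] Ae e by simp
    with y0 y show False by simp
  qed
  with y y0 Ay show ?thesis by blast
qed

text \<open>The matrix of the map sending \<open>x\<close> to
  \<open>(x \<bullet>c u) \<cdot>\<^sub>v u\<close>; for a unit vector \<open>u\<close> it is the
  orthogonal projection onto the line of \<open>u\<close>.\<close>

definition outer_square :: "complex vec \<Rightarrow> complex mat" where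
  "outer_square u = mat (dim_vec u) (dim_vec u) (\<lambda>(i, j). u $ i * cnj (u $ j))"

lemma outer_square_carrier [simp]: "u \<in> carrier_vec n \<Longrightarrow> outer_square u \<in> carrier_mat n n"
  by (simp add: outer_square_def)

lemma outer_square_mult_vec:
  assumes "u \<in> carrier_vec n" "x \<in> carrier_vec n"
  shows "outer_square u *\<^sub>v x = (x \<bullet>c u) \<cdot>\<^sub>v u"
  using assms
  by (intro eq_vecI) (auto simp: outer_square_def cscalar_prod_eq_sum scalar_prod_def
      lessThan_atLeast0 sum_distrib_right sum_distrib_left mult_ac)

lemma smult_mat_mult_vec:
  fixes A :: "complex mat"
  assumes "A \<in> carrier_mat m n" "x \<in> carrier_vec n"
  shows "(a \<cdot>\<^sub>m A) *\<^sub>v x = a \<cdot>\<^sub>v (A *\<^sub>v x)"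
  using assms by (intro eq_vecI) auto

lemma add_outer_square_mult_vec:
  assumes "M \<in> carrier_mat n n" "u \<in> carrier_vec n" "x \<in> carrier_vec n"
  shows "(M + a \<cdot>\<^sub>m outer_square u) *\<^sub>v x = M *\<^sub>v x + (a * (x \<bullet>c u)) \<cdot>\<^sub>v u"
  using assms
  by (simp add: add_mult_distrib_mat_vec[of _ n n] smult_mat_mult_vec[of _ n n]
      outer_square_mult_vec smult_smult_assoc)

lemma of_real_mult_cnj_nonneg: "0 \<le> l \<Longrightarrow> (0::complex) \<le> of_real l * (z * cnj z)"
  by (simp add: less_eq_complex_def complex_mult_cnj)

lemma pos_semidef_add_outer_square:
  assumes "M \<in> carrier_mat n n" "pos_semidef M" "u \<in> carrier_vec n" "0 \<le> l"
  shows "pos_semidef (M + of_real l \<cdot>\<^sub>m outer_square u)"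
proof (rule pos_semidefI[of _ n])
  fix x :: "complex vec" assume x: "x \<in> carrier_vec n"
  have "((M + of_real l \<cdot>\<^sub>m outer_square u) *\<^sub>v x) \<bullet>c x
    = (M *\<^sub>v x) \<bullet>c x + of_real l * ((x \<bullet>c u) * cnj (x \<bullet>c u))"
    using assms x by (simp add: add_outer_square_mult_vec cscalar_prod_linear cscalar_prod_cnj)
  then show "0 \<le> ((M + of_real l \<cdot>\<^sub>m outer_square u) *\<^sub>v x) \<bullet>c x"
    using pos_semidefD[OF assms(2,1) x] of_real_mult_cnj_nonneg[OF assms(4), of "x \<bullet>c u"] by simp
qed (use assms in simp)

text \<open>The matrix \<open>W\<close> with columns \<open>us\<close> is invertible with inverse
  \<open>W'\<close>, so \<open>x\<close> is \<open>W\<close> applied to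
  \<open>W' *\<^sub>v x\<close>. Moving \<open>W\<close> across the inner product leaves
  \<open>mat_adjoint W *\<^sub>v x\<close>, whose entries are the vanishing products with
  \<open>us\<close>.\<close>

lemma orthogonal_to_corthogonal_basis:
  fixes x :: "complex vec"
  assumes us: "set us \<subseteq> carrier_vec n" "corthogonal us" "length us = n"
    and x: "x \<in> carrier_vec n" and orth: "\<And>u. u \<in> set us \<Longrightarrow> x \<bullet>c u = 0"
  shows "x = 0\<^sub>v n"
proof -
  define W where "W = mat_of_cols n us"
  have W: "W \<in> carrier_mat n n" unfolding W_def using mat_of_cols_carrier(1)[of n us] us(3) by simp
  define W' where "W' = mat_of_rows n (map vec_inv us)"
  have W': "W' \<in> carrier_mat n n" unfolding W'_def using mat_of_rows_carrier(1)[of n "map vec_inv us"] us(3) by simp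
  have "W' * W = 1\<^sub>m n"
    using corthogonal_inv[OF us(2,1)] us(3) unfolding W'_def W_def inverts_mat_def by simp
  then have "W * W' = 1\<^sub>m n"
    using mat_mult_left_right_inverse[OF W' W] by simp
  then have xy: "x = W *\<^sub>v (W' *\<^sub>v x)"
    using assoc_mult_mat_vec[OF W W' x] x by simp
  have "mat_adjoint W *\<^sub>v x = 0\<^sub>v n"
  proof (rule eq_vecI)
    fix i assume "i < dim_vec (0\<^sub>v n :: complex vec)"
    then have i: "i < n" by simp
    have ui: "us ! i \<in> carrier_vec n" using i us nth_mem[of i us] by auto
    have "(mat_adjoint W *\<^sub>v x) $ i = x \<bullet>c (us ! i)"
      using i us(3) x W carrier_vecD[OF ui]
      by (auto simp: W_def cscalar_prod_eq_sum scalar_prod_def lessThan_atLeast0 mat_of_cols_index mult.commute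
          intro!: sum.cong)
    with orth[of "us ! i"] i us(3) show "(mat_adjoint W *\<^sub>v x) $ i = 0\<^sub>v n $ i" by simp
  qed (use W in simp)
  moreover have "x \<bullet>c x = (W' *\<^sub>v x) \<bullet>c (mat_adjoint W *\<^sub>v x)"
    using cscalar_prod_mat_adjoint[OF W, of "W' *\<^sub>v x" x] W' x xy by simp
  ultimately have "x \<bullet>c x = 0" using W' x by simp
  with x show ?thesis by simp
qed

section \<open>Deflation and the induction principle\<close>

lemma eigenvector_orthogonal_kernel:
  assumes A: "A \<in> carrier_mat n n" "pos_semidef A" and u: "u \<in> carrier_vec n"
    and Au: "A *\<^sub>v u = \<mu> \<cdot>\<^sub>v u" "\<mu> \<noteq> 0" and v: "v \<in> carrier_vec n" "A *\<^sub>v v = 0\<^sub>v n"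
  shows "u \<bullet>c v = 0"
proof -
  have "\<mu> * (u \<bullet>c v) = (A *\<^sub>v u) \<bullet>c v"
    using u v Au by (simp add: cscalar_prod_smult_left)
  also have "\<dots> = u \<bullet>c (A *\<^sub>v v)"
    using A pos_semidef_mat_adjoint[OF A(2,1)] u v by (intro hermitian_cscalar_prod)
  finally show ?thesis using Au v u by simp
qed

lemma pos_semidef_deflate:
  assumes A: "A \<in> carrier_mat n n" and psd: "pos_semidef A" and nz: "A \<noteq> 0\<^sub>m n n"
  obtains M l u where "M \<in> carrier_mat n n" "pos_semidef M" "u \<in> carrier_vec n" "cvec_norm u = 1"
    "M *\<^sub>v u = 0\<^sub>v n" "l > 0" "A *\<^sub>v u = of_real l \<cdot>\<^sub>v u" "A = M + of_real l \<cdot>\<^sub>m outer_square u"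
proof -
  have herm: "mat_adjoint A = A" using psd A by (rule pos_semidef_mat_adjoint)
  obtain \<mu> x where mu: "\<mu> \<noteq> 0" and x: "x \<in> carrier_vec n" and x0: "x \<noteq> 0\<^sub>v n" and Ax: "A *\<^sub>v x = \<mu> \<cdot>\<^sub>v x"
    using hermitian_eigenvector_exists[OF A herm nz] by blast
  have nx: "cvec_norm x > 0"
    using cvec_norm_eq_0_iff[OF x] x0 cvec_norm_nonneg[of x] by linarith
  have "0 \<le> \<mu> * of_real ((cvec_norm x)\<^sup>2)"
    using pos_semidefD[OF psd A x] Ax x by (simp add: cscalar_prod_smult_left cscalar_prod_self)
  \<comment> \<open>The form at \<open>x\<close> is \<mu> times a positive real, so \<mu> is itself
    real and nonnegative.\<close>
  with nx have "Im \<mu> = 0" "0 \<le> Re \<mu>"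
    by (auto simp: less_eq_complex_def zero_le_mult_iff)
  define l where "l = Re \<mu>"
  have mu_l: "\<mu> = of_real l" and l: "l > 0"
    using \<open>Im \<mu> = 0\<close> \<open>0 \<le> Re \<mu>\<close> mu by (auto simp: l_def complex_eq_iff)
  define u where "u = of_real (1 / cvec_norm x) \<cdot>\<^sub>v x"
  have u: "u \<in> carrier_vec n" using x by (simp add: u_def)
  have nu: "cvec_norm u = 1" unfolding u_def using x x0 by (rule cvec_norm_normalize)
  have uu: "u \<bullet>c u = 1" by (simp add: cscalar_prod_self nu)
  have Au: "A *\<^sub>v u = of_real l \<cdot>\<^sub>v u"
    unfolding u_def using mult_mat_vec[OF A x] Ax by (simp add: mu_l smult_smult_assoc mult.commute)
  define M where "M = A + of_real (- l) \<cdot>\<^sub>m outer_square u"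
  have M: "M \<in> carrier_mat n n" using A u by (simp add: M_def)
  have Mx: "M *\<^sub>v y = A *\<^sub>v y + (of_real (- l) * (y \<bullet>c u)) \<cdot>\<^sub>v u" if "y \<in> carrier_vec n" for y
    unfolding M_def using A u that by (rule add_outer_square_mult_vec)
  have Mu: "M *\<^sub>v u = 0\<^sub>v n"
    using Mx[OF u] Au uu u by (intro eq_vecI) auto
  have "pos_semidef M"
  proof (rule pos_semidefI[OF M])
    fix y :: "complex vec" assume y: "y \<in> carrier_vec n"
    \<comment> \<open>The component of \<open>y\<close> orthogonal to \<open>u\<close>. The form of
      \<open>M\<close> at \<open>y\<close> equals the form of \<open>A\<close> at \<open>z\<close>,
      so \<open>M\<close> inherits positivity.\<close>
    define z where "z = y - (y \<bullet>c u) \<cdot>\<^sub>v u"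
    have z: "z \<in> carrier_vec n" using y u by (simp add: z_def)
    have Auy: "(A *\<^sub>v y) \<bullet>c u = of_real l * (y \<bullet>c u)"
      using hermitian_cscalar_prod[OF A herm y u] Au y u by (simp add: cscalar_prod_smult_right)
    have "A *\<^sub>v z = A *\<^sub>v y - (of_real l * (y \<bullet>c u)) \<cdot>\<^sub>v u"
      unfolding z_def using A y u Au
      by (simp add: mult_minus_distrib_mat_vec[of _ n n] mult_mat_vec[of _ n n] smult_smult_assoc mult.commute)
    then have "(A *\<^sub>v z) \<bullet>c z = (A *\<^sub>v y - (of_real l * (y \<bullet>c u)) \<cdot>\<^sub>v u) \<bullet>c (y - (y \<bullet>c u) \<cdot>\<^sub>v u)"
      by (simp add: z_def)
    also have "\<dots> = (M *\<^sub>v y) \<bullet>c y"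
      using A y u by (simp add: Mx[OF y] cscalar_prod_linear Auy uu algebra_simps)
    finally show "0 \<le> (M *\<^sub>v y) \<bullet>c y" using pos_semidefD[OF psd A z] by simp
  qed
  moreover have "A = M + of_real l \<cdot>\<^sub>m outer_square u"
    unfolding M_def using A u by (intro eq_matI) (auto simp: outer_square_def)
  ultimately show thesis using that M u nu Mu l Au by blast
qed

text \<open>Stands in for the spectral theorem: \<open>A\<close> is built from zero by adding
  positive multiples of projections onto lines, each in the kernel of what was there before.\<close>

lemma pos_semidef_induct [consumes 2, case_names zero add]:
  assumes "A \<in> carrier_mat n n" "pos_semidef A"
    and zero: "P (0\<^sub>m n n)"
    and add: "\<And>M l u. \<lbrakk>M \<in> carrier_mat n n; pos_semidef M; u \<in> carrier_vec n; cvec_norm u = 1;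
      M *\<^sub>v u = 0\<^sub>v n; l > 0; P M\<rbrakk> \<Longrightarrow> P (M + of_real l \<cdot>\<^sub>m outer_square u)"
  shows "P A"
proof -
  \<comment> \<open>The list \<open>us\<close> collects the eigenvectors split off so far; it lies in the kernel of the remainder, and
    orthogonality bounds its length by \<open>n\<close>.\<close>
  have "P A" if "A \<in> carrier_mat n n" "pos_semidef A" "set us \<subseteq> carrier_vec n" "corthogonal us"
    "length us + m = n" "\<And>u. u \<in> set us \<Longrightarrow> A *\<^sub>v u = 0\<^sub>v n" for us :: "complex vec list" and A m
    using that
  proof (induction m arbitrary: A us)
    case (0 A us)
    note A = \<open>A \<in> carrier_mat n n\<close>
    have "A = 0\<^sub>m n n"
    \<comment> \<open>Here \<open>us\<close> is an orthogonal basis inside the kernel, while a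
      nonzero \<open>A\<close> would have a unit eigenvector orthogonal to all of it.\<close>
    proof (rule ccontr)
      assume "A \<noteq> 0\<^sub>m n n"
      then obtain M l u where u: "u \<in> carrier_vec n" "cvec_norm u = 1" "l > 0"
        "A *\<^sub>v u = of_real l \<cdot>\<^sub>v u"
        using pos_semidef_deflate[OF A 0(2)] by metis
      have "u \<bullet>c v = 0" if "v \<in> set us" for v
        using eigenvector_orthogonal_kernel[OF A 0(2) u(1,4), of v] that 0 u(3) by auto
      then have "u = 0\<^sub>v n"
        using orthogonal_to_corthogonal_basis[of us n u] 0 u by simp
      with u show False using cvec_norm_eq_0_iff[OF u(1)] by simp
    qed
    with zero show ?case by simp
  next
    case (Suc m A us)
    note A = \<open>A \<in> carrier_mat n n\<close>
    show ?case
    proof (cases "A = 0\<^sub>m n n")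
      case True
      with zero show ?thesis by simp
    next
      case False
      then obtain M l u where M: "M \<in> carrier_mat n n" "pos_semidef M"
        and u: "u \<in> carrier_vec n" "cvec_norm u = 1"
        and Mu: "M *\<^sub>v u = 0\<^sub>v n" and l: "l > 0" and Au: "A *\<^sub>v u = of_real l \<cdot>\<^sub>v u"
        and AM: "A = M + of_real l \<cdot>\<^sub>m outer_square u"
        using pos_semidef_deflate[OF A Suc.prems(2)] by metis
      have orth: "v \<bullet>c u = 0" "u \<bullet>c v = 0" if "v \<in> set us" for v
        using eigenvector_orthogonal_kernel[OF A Suc.prems(2) u(1) Au, of v] that l Suc.prems(3,6)
          cscalar_prod_cnj[of u v] u(1) by auto
      have "corthogonal (u # us)"
      proof (rule corthogonalI)
        fix i j assume ij: "i < length (u # us)" "j < length (u # us)"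
        have "u \<bullet>c u \<noteq> 0" by (simp add: cscalar_prod_self u)
        then show "(u # us) ! i \<bullet>c (u # us) ! j = 0 \<longleftrightarrow> i \<noteq> j"
          using ij orth corthogonalD[OF Suc.prems(4)]
          by (cases i; cases j) auto
      qed
      moreover have "M *\<^sub>v v = 0\<^sub>v n" if "v \<in> set us" for v
      proof -
        have v: "v \<in> carrier_vec n" using that Suc.prems(3) by auto
        have "A *\<^sub>v v = M *\<^sub>v v + (of_real l * (v \<bullet>c u)) \<cdot>\<^sub>v u"
          unfolding AM using M(1) u(1) v by (rule add_outer_square_mult_vec)
        then have "A *\<^sub>v v = M *\<^sub>v v"
          using orth(1)[OF that] M(1) u(1) by (intro eq_vecI) auto
        then show ?thesis using Suc.prems(6)[OF that] by simp
      qed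
      ultimately have "P M"
        using Suc.IH[OF M, of "u # us"] Suc.prems(3,5) u(1) Mu by auto
      then show ?thesis unfolding AM using add M u Mu l by blast
    qed
  qed
  from this[of A "[]" n] assms(1,2) show ?thesis by (simp add: corthogonal_def)
qed

section \<open>Positive square roots and idempotents\<close>

lemma pos_sqrt_exists:
  assumes "A \<in> carrier_mat n n" "pos_semidef A"
  shows "\<exists>B. B \<in> carrier_mat n n \<and> pos_semidef B \<and> B * B = A"
  using assms
proof (induction A rule: pos_semidef_induct)
  case zero
  have "0\<^sub>m n n *\<^sub>v x = (0\<^sub>v n :: complex vec)" if "x \<in> carrier_vec n" for x
    using that by (intro eq_vecI) auto
  then have "pos_semidef (0\<^sub>m n n)" by (intro pos_semidefI[of _ n]) simp_all
  then show ?case by (intro exI[of _ "0\<^sub>m n n"]) simp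
next
  case (add M l u)
  then obtain S where S: "S \<in> carrier_mat n n" "pos_semidef S" "S * S = M" by blast
  note herm = pos_semidef_mat_adjoint[OF S(2,1)]
  note u = \<open>u \<in> carrier_vec n\<close>
  have uu: "u \<bullet>c u = 1" using add.hyps by (simp add: cscalar_prod_self)
  have SSx: "S *\<^sub>v (S *\<^sub>v x) = M *\<^sub>v x" if "x \<in> carrier_vec n" for x
    using assoc_mult_mat_vec[OF S(1,1) that] S(3) by simp
  \<comment> \<open>The root \<open>S\<close> of \<open>M\<close> must also kill \<open>u\<close>,
    so that squaring \<open>B\<close> below produces no cross terms.\<close>
  have "(S *\<^sub>v u) \<bullet>c (S *\<^sub>v u) = u \<bullet>c (M *\<^sub>v u)"
    using hermitian_cscalar_prod[OF S(1) herm u, of "S *\<^sub>v u"] SSx[OF u] S(1) u by simp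
  then have Su: "S *\<^sub>v u = 0\<^sub>v n"
    using add.hyps S(1) by (simp add: conjugate_square_eq_0_vec[of _ n])
  define r where "r = complex_of_real (sqrt l)"
  have r: "r * r = of_real l" using add.hyps by (simp add: r_def flip: of_real_mult)
  define B where "B = S + r \<cdot>\<^sub>m outer_square u"
  have B: "B \<in> carrier_mat n n" using S u by (simp add: B_def)
  have Bx: "B *\<^sub>v x = S *\<^sub>v x + (r * (x \<bullet>c u)) \<cdot>\<^sub>v u" if "x \<in> carrier_vec n" for x
    unfolding B_def using S(1) u that by (rule add_outer_square_mult_vec)
  have "B * B = M + of_real l \<cdot>\<^sub>m outer_square u"
  proof (rule mat_eq_if_mult_vec_eq[of _ n n])
    fix x :: "complex vec" assume x: "x \<in> carrier_vec n"
    have Sx: "S *\<^sub>v x \<in> carrier_vec n" using S(1) x by simp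
    have "(S *\<^sub>v x) \<bullet>c u = 0"
      using hermitian_cscalar_prod[OF S(1) herm x u] Su x by simp
    then have 1: "(B *\<^sub>v x) \<bullet>c u = r * (x \<bullet>c u)"
      using Bx[OF x] S(1) u uu by (simp add: cscalar_prod_linear)
    have 2: "S *\<^sub>v (B *\<^sub>v x) = M *\<^sub>v x"
      using Bx[OF x] Sx u Su SSx[OF x] S(1) add.hyps(1) x
      by (simp add: mult_add_distrib_mat_vec[OF S(1)] mult_mat_vec[OF S(1)] right_zero_vec[of _ n])
    have "B *\<^sub>v (B *\<^sub>v x) = S *\<^sub>v (B *\<^sub>v x) + (r * ((B *\<^sub>v x) \<bullet>c u)) \<cdot>\<^sub>v u"
      using B x by (intro Bx) simp
    then have "B *\<^sub>v (B *\<^sub>v x) = M *\<^sub>v x + (of_real l * (x \<bullet>c u)) \<cdot>\<^sub>v u"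
      unfolding 1 2 using r by (simp add: mult.assoc [symmetric])
    then show "(B * B) *\<^sub>v x = (M + of_real l \<cdot>\<^sub>m outer_square u) *\<^sub>v x"
      using assoc_mult_mat_vec[OF B B x] add_outer_square_mult_vec[OF add.hyps(1) u x] by simp
  qed (use B u add.hyps(1) in auto)
  moreover have "pos_semidef B"
    unfolding B_def r_def using S(1,2) u add.hyps by (intro pos_semidef_add_outer_square) auto
  ultimately show ?case using B by blast
qed

text \<open>If the Hermitian difference \<open>D\<close> were nonzero, it would have an eigenvector
  \<open>x\<close> with nonzero real eigenvalue. Equality of the squares makes the forms of
  \<open>B\<close> and \<open>C\<close> vanish at \<open>x\<close>, hence also that of
  \<open>D\<close>, which is absurd.\<close>

lemma pos_sqrt_unique:
  assumes B: "B \<in> carrier_mat n n" "pos_semidef B" and C: "C \<in> carrier_mat n n" "pos_semidef C"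
    and eq: "B * B = C * C"
  shows "B = C"
proof (rule ccontr)
  assume "B \<noteq> C"
  define D where "D = B - C"
  have D: "D \<in> carrier_mat n n" unfolding D_def by (rule minus_carrier_mat[OF C(1)])
  have "D \<noteq> 0\<^sub>m n n"
  proof
    assume "D = 0\<^sub>m n n"
    then have "D $$ (i, j) = 0" if "i < n" "j < n" for i j using that by simp
    then have "B = C" using B C by (intro eq_matI) (auto simp: D_def)
    with \<open>B \<noteq> C\<close> show False ..
  qed
  note hB = pos_semidef_mat_adjoint[OF B(2,1)] and hC = pos_semidef_mat_adjoint[OF C(2,1)]
  have hD: "mat_adjoint D = D"
  proof (rule eq_matI)
    fix i j assume "i < dim_row D" "j < dim_col D"
    then have "i < n" "j < n" using D by auto
    moreover from this have "mat_adjoint B $$ (i, j) = B $$ (i, j)" "mat_adjoint C $$ (i, j) = C $$ (i, j)"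
      by (simp_all only: hB hC)
    ultimately show "mat_adjoint D $$ (i, j) = D $$ (i, j)"
      using B C D by (simp add: D_def)
  qed (use D in auto)
  obtain \<mu> x where mu: "\<mu> \<noteq> 0" and x: "x \<in> carrier_vec n" "x \<noteq> 0\<^sub>v n" and Dx: "D *\<^sub>v x = \<mu> \<cdot>\<^sub>v x"
    using hermitian_eigenvector_exists[OF D hD \<open>D \<noteq> 0\<^sub>m n n\<close>] by blast
  have xx: "x \<bullet>c x \<noteq> 0" using x by simp
  have "\<mu> * (x \<bullet>c x) = cnj \<mu> * (x \<bullet>c x)"
    using hermitian_cscalar_prod[OF D hD x(1) x(1)] Dx x by (simp add: cscalar_prod_linear)
  then have real: "cnj \<mu> = \<mu>" using xx by simp
  have Bx: "B *\<^sub>v x \<in> carrier_vec n" and Cx: "C *\<^sub>v x \<in> carrier_vec n" using B C x by auto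
  have Dy: "D *\<^sub>v y = B *\<^sub>v y - C *\<^sub>v y" if "y \<in> carrier_vec n" for y
    unfolding D_def using B(1) C(1) that by (rule minus_mult_distrib_mat_vec)
  have BB: "B *\<^sub>v (B *\<^sub>v x) = C *\<^sub>v (C *\<^sub>v x)"
    using assoc_mult_mat_vec[OF B(1) B(1) x(1)] assoc_mult_mat_vec[OF C(1) C(1) x(1)] eq by simp
  \<comment> \<open>\<open>B\<^sup>2 - C\<^sup>2 = B D + D C\<close> needs no commutativity; at the eigenvector \<open>x\<close> of \<open>D\<close> it forces
    \<open>\<mu> (\<langle>B x, x\<rangle> + \<langle>C x, x\<rangle>) = 0\<close>.\<close>
  have "(B *\<^sub>v (D *\<^sub>v x)) \<bullet>c x + (D *\<^sub>v (C *\<^sub>v x)) \<bullet>c x = 0"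
    using x Bx Cx B C
    by (simp add: Dy mult_minus_distrib_mat_vec[OF B(1)] BB cscalar_prod_linear)
  moreover have "(B *\<^sub>v (D *\<^sub>v x)) \<bullet>c x = \<mu> * ((B *\<^sub>v x) \<bullet>c x)"
    unfolding Dx using x B by (simp add: mult_mat_vec[OF B(1)] cscalar_prod_linear)
  moreover have "(D *\<^sub>v (C *\<^sub>v x)) \<bullet>c x = \<mu> * ((C *\<^sub>v x) \<bullet>c x)"
    using hermitian_cscalar_prod[OF D hD Cx x(1)] Dx x C real by (simp add: cscalar_prod_linear)
  ultimately have "(B *\<^sub>v x) \<bullet>c x + (C *\<^sub>v x) \<bullet>c x = 0"
    using mu by (simp flip: distrib_left)
  then have "(B *\<^sub>v x) \<bullet>c x = 0" "(C *\<^sub>v x) \<bullet>c x = 0"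
    using pos_semidefD[OF B(2,1) x(1)] pos_semidefD[OF C(2,1) x(1)]
    by (simp_all add: add_nonneg_eq_0_iff)
  then have "(D *\<^sub>v x) \<bullet>c x = 0"
    using Dy[OF x(1)] B(1) C(1) x by (simp add: cscalar_prod_linear)
  with Dx mu xx x show False by (simp add: cscalar_prod_linear)
qed

text \<open>Uniqueness resolves the definite description in \<open>pos_sqrt\<close>: exhibiting one
  positive semidefinite root suffices to compute it.\<close>

lemma pos_sqrt_eqI:
  assumes "B \<in> carrier_mat n n" "pos_semidef B"
  shows "pos_sqrt (B * B) = B"
  unfolding pos_sqrt_def using assms by (intro the_equality) (auto intro: pos_sqrt_unique)

lemma pos_sqrt_square:
  assumes "A \<in> carrier_mat n n" "pos_semidef A"
  shows "pos_sqrt A \<in> carrier_mat n n" "pos_sqrt A * pos_sqrt A = A"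
  using pos_sqrt_exists[OF assms] pos_sqrt_eqI by auto

lemma pos_semidef_adjoint_mult:
  assumes "A \<in> carrier_mat n n"
  shows "pos_semidef (mat_adjoint A * A)"
proof (rule pos_semidefI[of _ n])
  fix x :: "complex vec" assume x: "x \<in> carrier_vec n"
  show "0 \<le> ((mat_adjoint A * A) *\<^sub>v x) \<bullet>c x"
    using cscalar_prod_mat_adjoint[of "mat_adjoint A" n n "A *\<^sub>v x" x] assms x
      conjugate_square_ge_0_vec[of "A *\<^sub>v x"]
    by (simp add: assoc_mult_mat_vec[of _ n n _ n])
qed (use assms in auto)

text \<open>Along the induction, the eigenvalue hypothesis gives \<open>l = 1\<close> for the added
  term. It also passes down to \<open>M\<close>, whose eigenvectors for nonzero eigenvalues are
  orthogonal to \<open>u\<close> and so are eigenvectors of the sum with the same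
  eigenvalue.\<close>

lemma pos_semidef_idempotent:
  assumes "A \<in> carrier_mat n n" "pos_semidef A"
    and "\<And>\<mu> x. \<mu> \<noteq> 0 \<Longrightarrow> x \<in> carrier_vec n \<Longrightarrow> x \<noteq> 0\<^sub>v n \<Longrightarrow> A *\<^sub>v x = \<mu> \<cdot>\<^sub>v x \<Longrightarrow> \<mu> = 1"
  shows "A * A = A"
  using assms
proof (induction A rule: pos_semidef_induct)
  case zero
  show ?case by simp
next
  case (add M l u)
  note M = \<open>M \<in> carrier_mat n n\<close> \<open>pos_semidef M\<close>
  note u = \<open>u \<in> carrier_vec n\<close> and Mu = \<open>M *\<^sub>v u = 0\<^sub>v n\<close>
  have uu: "u \<bullet>c u = 1" using \<open>cvec_norm u = 1\<close> by (simp add: cscalar_prod_self)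
  have u0: "u \<noteq> 0\<^sub>v n" using \<open>cvec_norm u = 1\<close> cvec_norm_eq_0_iff[OF u] by auto
  define A where "A = M + of_real l \<cdot>\<^sub>m outer_square u"
  have A: "A \<in> carrier_mat n n" using M u by (simp add: A_def)
  have Ax: "A *\<^sub>v x = M *\<^sub>v x + (of_real l * (x \<bullet>c u)) \<cdot>\<^sub>v u" if "x \<in> carrier_vec n" for x
    unfolding A_def using M(1) u that by (rule add_outer_square_mult_vec)
  have "A *\<^sub>v u = of_real l \<cdot>\<^sub>v u" using Ax[OF u] Mu uu u by simp
  with add.prems[of "of_real l" u] \<open>l > 0\<close> u u0 have l: "l = 1" by (simp add: A_def)
  have "\<mu> = 1" if "\<mu> \<noteq> 0" "x \<in> carrier_vec n" "x \<noteq> 0\<^sub>v n" "M *\<^sub>v x = \<mu> \<cdot>\<^sub>v x" for \<mu> x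
  proof -
    have "x \<bullet>c u = 0"
      using eigenvector_orthogonal_kernel[OF M that(2,4,1) u Mu] .
    then have "A *\<^sub>v x = \<mu> \<cdot>\<^sub>v x"
      using Ax[OF that(2)] that M(1) u by (intro eq_vecI) auto
    with add.prems[of \<mu> x] that show ?thesis by (simp add: A_def)
  qed
  then have MM: "M * M = M" by (rule add.IH)
  have "A * A = A"
  proof (rule mat_eq_if_mult_vec_eq[of _ n n])
    fix x :: "complex vec" assume x: "x \<in> carrier_vec n"
    have Mx: "M *\<^sub>v x \<in> carrier_vec n" using M(1) x by simp
    have "(M *\<^sub>v x) \<bullet>c u = 0"
      using hermitian_cscalar_prod[OF M(1) pos_semidef_mat_adjoint[OF M(2,1)] x u] Mu x by simp
    then have 1: "(A *\<^sub>v x) \<bullet>c u = x \<bullet>c u"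
      using Ax[OF x] M(1) u uu l by (simp add: cscalar_prod_linear)
    have "M *\<^sub>v (M *\<^sub>v x) = M *\<^sub>v x"
      using assoc_mult_mat_vec[OF M(1) M(1) x] MM by simp
    then have 2: "M *\<^sub>v (A *\<^sub>v x) = M *\<^sub>v x"
      using Ax[OF x] Mx u Mu x M(1)
      by (simp add: mult_add_distrib_mat_vec[OF M(1)] mult_mat_vec[OF M(1)] right_zero_vec[of _ n])
    have "A *\<^sub>v (A *\<^sub>v x) = M *\<^sub>v (A *\<^sub>v x) + (of_real l * ((A *\<^sub>v x) \<bullet>c u)) \<cdot>\<^sub>v u"
      using A x by (intro Ax) simp
    then have "A *\<^sub>v (A *\<^sub>v x) = A *\<^sub>v x"
      unfolding 1 2 using Ax[OF x] by simp
    then show "(A * A) *\<^sub>v x = A *\<^sub>v x"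
      using assoc_mult_mat_vec[OF A A x] by simp
  qed (use A in auto)
  then show ?case by (simp add: A_def)
qed

section \<open>Partial isometries\<close>

lemma adjoint_mult_cscalar_prod:
  fixes V :: "complex mat"
  assumes "V \<in> carrier_mat n n" "x \<in> carrier_vec n" "y \<in> carrier_vec n"
  shows "((mat_adjoint V * V) *\<^sub>v x) \<bullet>c y = (V *\<^sub>v x) \<bullet>c (V *\<^sub>v y)"
  using cscalar_prod_mat_adjoint[of "mat_adjoint V" n n "V *\<^sub>v x" y] assms
  by (simp add: assoc_mult_mat_vec[of _ n n _ n])

text \<open>An eigenvector of \<open>mat_adjoint V * V\<close> with nonzero eigenvalue is orthogonal
  to the kernel of \<open>V\<close>. There \<open>V\<close> is isometric, which forces the
  eigenvalue to be 1.\<close>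

lemma partial_isometry_idempotent:
  assumes V: "V \<in> carrier_mat n n" and pi: "partial_isometry V"
  shows "(mat_adjoint V * V) * (mat_adjoint V * V) = mat_adjoint V * V"
proof (rule pos_semidef_idempotent[of _ n])
  let ?A = "mat_adjoint V * V"
  show A: "?A \<in> carrier_mat n n" using V by auto
  show psd: "pos_semidef ?A" using V by (rule pos_semidef_adjoint_mult)
  fix \<mu> x assume mu: "\<mu> \<noteq> 0" and x: "x \<in> carrier_vec n" "x \<noteq> 0\<^sub>v n" and Ax: "?A *\<^sub>v x = \<mu> \<cdot>\<^sub>v x"
  have "x \<bullet>c y = 0" if "y \<in> mat_kernel V" for y
  proof -
    have y: "y \<in> carrier_vec n" "V *\<^sub>v y = 0\<^sub>v n" using that V by (auto simp: mat_kernel_def)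
    have "\<mu> * (x \<bullet>c y) = 0"
      using adjoint_mult_cscalar_prod[OF V x(1) y(1)] Ax y x V by (simp add: cscalar_prod_linear)
    with mu show ?thesis by simp
  qed
  then have "cvec_norm (V *\<^sub>v x) = cvec_norm x"
    using pi V x unfolding partial_isometry_def by auto
  then have "\<mu> * (x \<bullet>c x) = x \<bullet>c x"
    using adjoint_mult_cscalar_prod[OF V x(1) x(1)] Ax x
    by (simp add: cscalar_prod_smult_left cscalar_prod_self)
  then show "\<mu> = 1" using x by simp
qed

text \<open>Pythagoras for the projection \<open>mat_adjoint V * V\<close>, whose value at
  \<open>x\<close> has the same norm as \<open>V *\<^sub>v x\<close>. Nonnegativity gives
  contractivity; vanishing of the right side gives a fixed vector, which settles the equality
  case.\<close>

lemma partial_isometry_defect: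
  assumes V: "V \<in> carrier_mat n n" and pi: "partial_isometry V" and x: "x \<in> carrier_vec n"
  shows "(cvec_norm (x - (mat_adjoint V * V) *\<^sub>v x))\<^sup>2 = (cvec_norm x)\<^sup>2 - (cvec_norm (V *\<^sub>v x))\<^sup>2"
proof -
  define A where "A = mat_adjoint V * V"
  have A: "A \<in> carrier_mat n n" using V by (auto simp: A_def)
  have herm: "mat_adjoint A = A"
    using pos_semidef_mat_adjoint[OF _ A] pos_semidef_adjoint_mult[OF V] by (simp add: A_def)
  have AA: "A *\<^sub>v (A *\<^sub>v x) = A *\<^sub>v x"
    using assoc_mult_mat_vec[OF A A x] partial_isometry_idempotent[OF V pi] by (simp add: A_def)
  have Ax: "A *\<^sub>v x \<in> carrier_vec n" using A x by simp
  have 1: "x \<bullet>c (A *\<^sub>v x) = (V *\<^sub>v x) \<bullet>c (V *\<^sub>v x)"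
    using hermitian_cscalar_prod[OF A herm x x] adjoint_mult_cscalar_prod[OF V x x]
    by (simp add: A_def)
  have "(A *\<^sub>v x) \<bullet>c (A *\<^sub>v x) = x \<bullet>c (A *\<^sub>v x)"
    using hermitian_cscalar_prod[OF A herm x Ax] AA by simp
  with 1 have "(cvec_norm (A *\<^sub>v x))\<^sup>2 = (cvec_norm (V *\<^sub>v x))\<^sup>2"
    by (simp only: cscalar_prod_self of_real_eq_iff)
  moreover from 1 have "Re (x \<bullet>c (A *\<^sub>v x)) = (cvec_norm (V *\<^sub>v x))\<^sup>2"
    by (simp only: cscalar_prod_self Re_complex_of_real)
  ultimately show ?thesis
    using x A by (simp add: cvec_norm_diff_square flip: A_def)
qed

lemma partial_isometry_norm_le:
  assumes "V \<in> carrier_mat n n" "partial_isometry V" "x \<in> carrier_vec n"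
  shows "(cvec_norm (V *\<^sub>v x))\<^sup>2 \<le> (cvec_norm x)\<^sup>2"
  using partial_isometry_defect[OF assms] by (metis diff_ge_0_iff_ge zero_le_power2)

text \<open>With \<open>y\<close> the image of \<open>x\<close> under the adjoint, expand the
  squared norm of \<open>x - V *\<^sub>v y\<close>. The cross term contributes minus twice the
  squared norm of \<open>y\<close>, and contractivity of \<open>V\<close> gives back at most one
  copy.\<close>

lemma partial_isometry_adjoint_norm_le:
  assumes V: "V \<in> carrier_mat n n" and pi: "partial_isometry V" and x: "x \<in> carrier_vec n"
  shows "(cvec_norm (mat_adjoint V *\<^sub>v x))\<^sup>2 \<le> (cvec_norm x)\<^sup>2"
proof -
  define y where "y = mat_adjoint V *\<^sub>v x"
  have y: "y \<in> carrier_vec n"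
    unfolding y_def using mat_adjoint_carrier[OF V] x by (rule mult_mat_vec_carrier)
  have "x \<bullet>c (V *\<^sub>v y) = y \<bullet>c y"
    using cscalar_prod_mat_adjoint[of "mat_adjoint V" n n x y] V x y by (simp add: y_def)
  then have "Re (x \<bullet>c (V *\<^sub>v y)) = (cvec_norm y)\<^sup>2"
    by (simp only: cscalar_prod_self Re_complex_of_real)
  moreover have "(cvec_norm (x - V *\<^sub>v y))\<^sup>2
    = (cvec_norm x)\<^sup>2 + (cvec_norm (V *\<^sub>v y))\<^sup>2 - 2 * Re (x \<bullet>c (V *\<^sub>v y))"
    using V x by (intro cvec_norm_diff_square) auto
  ultimately have "(cvec_norm y)\<^sup>2 \<le> (cvec_norm x)\<^sup>2"
    using partial_isometry_norm_le[OF V pi y] zero_le_power2[of "cvec_norm (x - V *\<^sub>v y)"] by linarith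
  then show ?thesis by (simp only: y_def)
qed

section \<open>Rank-one projections\<close>

text \<open>A maximal independent set of columns has exactly one member \<open>v\<close>. Any
  further column independent of \<open>v\<close> would push the rank to at least 2.\<close>

lemma (in vec_space) rank_one_cols:
  assumes A: "A \<in> carrier_mat n nc" and rank: "rank A = 1"
  obtains v where "v \<in> set (cols A)" "v \<noteq> 0\<^sub>v n" "\<And>w. w \<in> set (cols A) \<Longrightarrow> \<exists>c. w = c \<cdot>\<^sub>v v"
proof -
  have carr: "set (cols A) \<subseteq> carrier_vec n" using A cols_dim by blast
  obtain S where S: "maximal S (\<lambda>T. T \<subseteq> set (cols A) \<and> lin_indpt T)"
    using maximal_exists_superset[of "set (cols A)" "\<lambda>T. T \<subseteq> set (cols A) \<and> lin_indpt T" "{}"]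
    by (auto simp: lin_dep_def)
  have "card S = 1" using rank_card_indpt[OF A S] rank by simp
  then obtain v where v: "S = {v}" by (auto simp: card_1_singleton_iff)
  with S have vA: "v \<in> set (cols A)" and li: "lin_indpt {v}" by (auto simp: maximal_def)
  with carr have vc: "v \<in> carrier_vec n" by auto
  have "(UNIV :: 'a set) \<noteq> {0}" by (metis UNIV_I singletonD zero_neq_one)
  then have "v \<noteq> 0\<^sub>v n" using zero_nin_lin_indpt[of "{v}"] li vc by auto
  moreover have "\<exists>c. w = c \<cdot>\<^sub>v v" if w: "w \<in> set (cols A)" for w
  \<comment> \<open>The case split keeps \<open>{v} \<union> {w}\<close> a genuine two-element set
    in the cardinality argument.\<close>
  proof (cases "w = v")
    case True
    then show ?thesis by (intro exI[of _ 1]) simp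
  next
    case False
    have "lin_dep ({v} \<union> {w})"
    proof (rule ccontr)
      assume "\<not> lin_dep ({v} \<union> {w})"
      then have "card ({v} \<union> {w}) \<le> rank A"
        using w vA by (intro rank_ge_card_indpt[OF A]) auto
      then have "card ({v} \<union> {w}) \<le> 1" by (simp only: rank)
      with False show False by simp
    qed
    moreover have "w \<in> carrier_vec n" using carr w by blast
    ultimately have "w \<in> span {v}"
      using lin_dep_iff_in_span[of "{v}" w] li vc False by simp
    then obtain a B where B: "B \<subseteq> {v}" "w = lincomb a B" unfolding span_def by blast
    then consider "B = {}" | "B = {v}" by blast
    then show ?thesis
    proof cases
      case 1
      with B vc show ?thesis by (intro exI[of _ 0]) (auto simp: lincomb_def)
    next
      case 2
      with B vc have "w = a v \<cdot>\<^sub>v v" by (auto simp: lincomb_def)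
      then show ?thesis by blast
    qed
  qed
  ultimately show thesis using that vA by blast
qed

text \<open>Normalizing a nonzero column gives a unit vector \<open>u\<close> fixed by
  \<open>Q\<close>. Every column is a multiple of \<open>u\<close>, and self-adjointness of
  \<open>Q\<close> identifies the coefficient.\<close>

lemma rank_one_projection_eq_outer_square:
  assumes Q: "Q \<in> carrier_mat n n" and proj: "orthogonal_projection Q" and rank: "vec_space.rank n Q = 1"
  obtains u where "u \<in> carrier_vec n" "cvec_norm u = 1" "Q = outer_square u"
proof -
  interpret vec_space "TYPE(complex)" n .
  obtain v where v: "v \<in> set (cols Q)" "v \<noteq> 0\<^sub>v n"
    and mult: "\<And>w. w \<in> set (cols Q) \<Longrightarrow> \<exists>c. w = c \<cdot>\<^sub>v v"
    using rank_one_cols[OF Q rank] by blast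
  have vc: "v \<in> carrier_vec n" using v(1) Q cols_dim by blast
  have QQ: "Q * Q = Q" and herm: "mat_adjoint Q = Q" using proj by (auto simp: orthogonal_projection_def)
  obtain j where j: "j < n" "v = col Q j" using v(1) Q by (auto simp: cols_def)
  have col_eq: "Q *\<^sub>v unit_vec n k = col Q k" if "k < n" for k
    using Q that by (intro eq_vecI) auto
  have Qv: "Q *\<^sub>v v = v"
    using assoc_mult_mat_vec[OF Q Q unit_vec_carrier, of j] QQ col_eq[OF j(1)] j(2) by simp
  define a where "a = complex_of_real (1 / cvec_norm v)"
  define u where "u = a \<cdot>\<^sub>v v"
  have u: "u \<in> carrier_vec n" using vc by (simp add: u_def)
  have nu: "cvec_norm u = 1" unfolding u_def a_def using vc v(2) by (rule cvec_norm_normalize)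
  have Qu: "Q *\<^sub>v u = u" unfolding u_def using mult_mat_vec[OF Q vc] Qv by simp
  have a0: "a \<noteq> 0" using cvec_norm_eq_0_iff[OF vc] v(2) by (simp add: a_def)
  have "Q = outer_square u"
  proof (rule eq_matI)
    fix i k assume "i < dim_row (outer_square u)" "k < dim_col (outer_square u)"
    then have i: "i < n" and k: "k < n" using u by (auto simp: outer_square_def)
    have "col Q k \<in> set (cols Q)" using k Q by (auto simp: cols_def)
    then obtain c where "col Q k = c \<cdot>\<^sub>v v" using mult by blast
    then have c: "col Q k = (c / a) \<cdot>\<^sub>v u"
      using a0 by (simp add: u_def smult_smult_assoc)
    have "c / a = col Q k \<bullet>c u"
      unfolding c using u nu by (simp add: cscalar_prod_smult_left cscalar_prod_self)
    also have "\<dots> = unit_vec n k \<bullet>c u"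
      using hermitian_cscalar_prod[OF Q herm unit_vec_carrier u, of k] col_eq[OF k] Qu by simp
    also have "\<dots> = cnj (u $ k)"
      using u k by simp
    finally have "col Q k $ i = u $ i * cnj (u $ k)" unfolding c using u i by simp
    then show "Q $$ (i, k) = outer_square u $$ (i, k)"
      using i k Q u by (simp add: outer_square_def)
  qed (use Q u in \<open>auto simp: outer_square_def\<close>)
  with u nu show thesis using that by blast
qed

lemma mat_trace_outer_square_mult:
  assumes "M \<in> carrier_mat n n" "u \<in> carrier_vec n"
  shows "mat_trace (outer_square u * M) = (M *\<^sub>v u) \<bullet>c u"
proof -
  have "mat_trace (outer_square u * M) = (\<Sum>i<n. \<Sum>k<n. u $ i * cnj (u $ k) * M $$ (k, i))"
    using assms by (simp add: mat_trace_def outer_square_def scalar_prod_def lessThan_atLeast0)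
  also have "\<dots> = (\<Sum>k<n. \<Sum>i<n. u $ i * cnj (u $ k) * M $$ (k, i))"
    by (rule sum.swap)
  also have "\<dots> = (M *\<^sub>v u) \<bullet>c u"
    using assms
    by (simp add: cscalar_prod_eq_sum scalar_prod_def lessThan_atLeast0 sum_distrib_left mult_ac)
  finally show ?thesis .
qed

section \<open>The fourth moment\<close>

text \<open>The real-variable core. It is applied with \<open>s\<close> the squared norm of
  \<open>c\<close>, \<open>t\<close> the modulus of \<nu>, and \<open>z\<close> the modulus of the
  product of \<open>mat_adjoint V *\<^sub>v c\<close> with \<open>c\<close>.\<close>

lemma four_thirds_bound:
  fixes N s t z :: real
  assumes N: "N \<le> s + t\<^sup>2 * s + 2 * t * z" and z: "z\<^sup>2 \<le> (s - s\<^sup>2) * s"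
    and "0 \<le> s" "0 \<le> t" "0 \<le> z" and st: "s + t\<^sup>2 \<le> 1"
  shows "N \<le> 4 / 3" "N = 4 / 3 \<Longrightarrow> s + t\<^sup>2 = 1"
proof -
  define r where "r = sqrt (1 - s)"
  have s1: "s \<le> 1" using st zero_le_power2[of t] by linarith
  have r: "0 \<le> r" "r\<^sup>2 = 1 - s" using s1 by (auto simp: r_def)
  have "t\<^sup>2 \<le> r\<^sup>2" using st r(2) by linarith
  then have tr: "t \<le> r" using r(1) by (rule power2_le_imp_le)
  have "z\<^sup>2 \<le> (s * r)\<^sup>2"
    using z unfolding power_mult_distrib r(2) by (simp add: power2_eq_square algebra_simps)
  moreover have "0 \<le> s * r" using \<open>0 \<le> s\<close> r(1) by simp
  ultimately have "z \<le> s * r" by (rule power2_le_imp_le)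
  then have "t * z \<le> t * (s * r)" using \<open>0 \<le> t\<close> by (rule mult_left_mono)
  with N have N': "N \<le> s * (1 + t\<^sup>2 + 2 * t * r)" by (simp add: algebra_simps)
  have "t * t \<le> r * r" "t * r \<le> r * r" using tr \<open>0 \<le> t\<close> r(1) by (simp_all add: mult_mono)
  then have tr2: "t\<^sup>2 \<le> r\<^sup>2" "t * r \<le> r\<^sup>2" by (simp_all add: power2_eq_square)
  have "s * (1 + t\<^sup>2 + 2 * t * r) \<le> s * (1 + 3 * r\<^sup>2)"
    using tr2 \<open>0 \<le> s\<close> by (intro mult_left_mono) auto
  \<comment> \<open>Completing the square: the maximum 4/3 is at s = 2/3.\<close>
  moreover have "s * (1 + 3 * r\<^sup>2) = 4 / 3 - 3 * (s - 2 / 3)\<^sup>2"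
    unfolding r(2) by (simp add: power2_eq_square algebra_simps)
  moreover have "0 \<le> 3 * (s - 2 / 3)\<^sup>2" by simp
  ultimately have *: "N \<le> s * (1 + t\<^sup>2 + 2 * t * r)" "s * (1 + t\<^sup>2 + 2 * t * r) \<le> s * (1 + 3 * r\<^sup>2)"
    "s * (1 + 3 * r\<^sup>2) \<le> 4 / 3"
    using N' by linarith+
  then show "N \<le> 4 / 3" by linarith
  assume eq: "N = 4 / 3"
  \<comment> \<open>Equality makes the whole chain tight. Since \<open>s\<close> is nonzero it can
    be cancelled, and then both bounds in \<open>tr2\<close> must be equalities.\<close>
  then have "s \<noteq> 0" using N' by auto
  moreover have "s * (1 + t\<^sup>2 + 2 * t * r) = s * (1 + 3 * r\<^sup>2)" using * eq by linarith
  ultimately have "t\<^sup>2 + 2 * (t * r) = 3 * r\<^sup>2" by simp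
  with tr2 have "t\<^sup>2 = r\<^sup>2" by linarith
  then show "s + t\<^sup>2 = 1" using r by simp
qed

text \<open>The number \<open>N\<close> is the trace to be bounded, written as a squared norm. The
  bound rests on contractivity of \<open>V\<close> and its adjoint; the partial isometry enters only
  when norm one is turned into a fixed vector.\<close>

lemma contraction_fourth_moment:
  fixes V :: "complex mat"
  assumes V: "V \<in> carrier_mat n n" and u: "u \<in> carrier_vec n" "cvec_norm u = 1"
    and V_le: "\<And>x. x \<in> carrier_vec n \<Longrightarrow> (cvec_norm (V *\<^sub>v x))\<^sup>2 \<le> (cvec_norm x)\<^sup>2"
    and V_adj_le: "\<And>x. x \<in> carrier_vec n \<Longrightarrow> (cvec_norm (mat_adjoint V *\<^sub>v x))\<^sup>2 \<le> (cvec_norm x)\<^sup>2"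
  defines "\<nu> \<equiv> (V *\<^sub>v u) \<bullet>c u"
  defines "B \<equiv> V - \<nu> \<cdot>\<^sub>m 1\<^sub>m n"
  defines "N \<equiv> (cvec_norm (mat_adjoint B *\<^sub>v (B *\<^sub>v u)))\<^sup>2"
  shows "N \<le> 4 / 3" "N = 4 / 3 \<Longrightarrow> (cvec_norm (V *\<^sub>v u))\<^sup>2 = 1"
proof -
  have uu: "u \<bullet>c u = 1" using u by (simp add: cscalar_prod_self)
  have Va: "mat_adjoint V \<in> carrier_mat n n" using V by (rule mat_adjoint_carrier)
  define c where "c = V *\<^sub>v u - \<nu> \<cdot>\<^sub>v u"
  have Vu: "V *\<^sub>v u \<in> carrier_vec n" using V u by simp
  have c: "c \<in> carrier_vec n" using V u by (simp add: c_def)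
  have dc [simp]: "dim_vec c = n" "dim_vec u = n" "dim_row V = n" "dim_col V = n" using c u V by auto
  have Bu: "B *\<^sub>v u = c"
    unfolding B_def c_def using V u
    by (simp add: minus_mult_distrib_mat_vec[of _ n n] smult_mat_mult_vec[of _ n n])
  have "mat_adjoint B = mat_adjoint V - cnj \<nu> \<cdot>\<^sub>m 1\<^sub>m n"
    unfolding B_def using V by (intro eq_matI) auto
  then have BBu: "mat_adjoint B *\<^sub>v (B *\<^sub>v u) = mat_adjoint V *\<^sub>v c - cnj \<nu> \<cdot>\<^sub>v c"
    unfolding Bu using Va c
    by (simp add: minus_mult_distrib_mat_vec[of _ n n] smult_mat_mult_vec[of _ n n])
  define s where "s = (cvec_norm c)\<^sup>2"
  define y where "y = mat_adjoint V *\<^sub>v c"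
  have y: "y \<in> carrier_vec n" unfolding y_def using Va c by (rule mult_mat_vec_carrier)
  have dy [simp]: "dim_vec y = n" using y by simp
  have cu: "c \<bullet>c u = 0" by (simp add: c_def cscalar_prod_linear uu flip: \<nu>_def)
  have uc: "u \<bullet>c c = 0" using cscalar_prod_cnj[of c u] cu by simp
  have Vu_eq: "V *\<^sub>v u = c + \<nu> \<cdot>\<^sub>v u" unfolding c_def by (intro eq_vecI) auto
  have p: "(cvec_norm (V *\<^sub>v u))\<^sup>2 = s + (cmod \<nu>)\<^sup>2"
  proof -
    have "(V *\<^sub>v u) \<bullet>c (V *\<^sub>v u) = c \<bullet>c c + \<nu> * cnj \<nu>"
      unfolding Vu_eq by (simp add: cscalar_prod_linear cu uc uu)
    then have "complex_of_real ((cvec_norm (V *\<^sub>v u))\<^sup>2) = complex_of_real (s + (cmod \<nu>)\<^sup>2)"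
      by (simp only: cscalar_prod_self s_def complex_norm_square of_real_add)
    then show ?thesis by (simp only: of_real_eq_iff)
  qed
  have st: "s + (cmod \<nu>)\<^sup>2 \<le> 1" using p V_le[OF u(1)] u(2) by simp
  \<comment> \<open>As \<open>c\<close> is orthogonal to \<open>u\<close>, only the \<open>c\<close>
    part of \<open>V *\<^sub>v u\<close> survives, so the component of \<open>y\<close> along
    \<open>u\<close> is exactly \<open>s\<close>.\<close>
  have "y \<bullet>c u = c \<bullet>c (V *\<^sub>v u)"
    using cscalar_prod_mat_adjoint[OF Va c u(1)] by (simp add: y_def)
  also have "\<dots> = of_real s"
    unfolding Vu_eq by (simp add: cscalar_prod_linear cu) (simp add: cscalar_prod_self s_def)
  finally have yu: "y \<bullet>c u = of_real s" .
  have ys: "(cvec_norm y)\<^sup>2 \<le> s" using V_adj_le[OF c] by (simp add: y_def s_def)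
  \<comment> \<open>Since \<open>c\<close> is orthogonal to \<open>u\<close>, only the component of \<open>y\<close> orthogonal to \<open>u\<close> matters in \<open>y \<bullet>c c\<close>.\<close>
  define d where "d = y - of_real s \<cdot>\<^sub>v u"
  have d: "d \<in> carrier_vec n" using y u by (simp add: d_def)
  have "(cvec_norm d)\<^sup>2 = (cvec_norm y)\<^sup>2 - s\<^sup>2"
    unfolding d_def using u(2)
    by (subst cvec_norm_diff_square)
      (simp_all add: cvec_norm_smult_square cscalar_prod_smult_right yu, simp add: power2_eq_square)
  with ys have ds: "(cvec_norm d)\<^sup>2 \<le> s - s\<^sup>2" by simp
  have "d \<bullet>c c = y \<bullet>c c" unfolding d_def by (simp add: cscalar_prod_linear uc)
  then have "(cmod (y \<bullet>c c))\<^sup>2 \<le> (cvec_norm d)\<^sup>2 * s"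
    using cscalar_prod_Cauchy_Schwarz[OF d c] by (simp add: s_def)
  also have "\<dots> \<le> (s - s\<^sup>2) * s" using ds by (intro mult_right_mono) (simp_all add: s_def)
  finally have z: "(cmod (y \<bullet>c c))\<^sup>2 \<le> (s - s\<^sup>2) * s" .
  have "N = (cvec_norm y)\<^sup>2 + (cmod \<nu>)\<^sup>2 * s - 2 * Re (\<nu> * (y \<bullet>c c))"
    unfolding N_def BBu y_def [symmetric] s_def
    by (subst cvec_norm_diff_square) (simp_all add: cvec_norm_smult_square cscalar_prod_smult_right)
  moreover have "- Re (\<nu> * (y \<bullet>c c)) \<le> cmod \<nu> * cmod (y \<bullet>c c)"
    using abs_Re_le_cmod[of "\<nu> * (y \<bullet>c c)"] by (simp only: norm_mult)
  ultimately have N: "N \<le> s + (cmod \<nu>)\<^sup>2 * s + 2 * cmod \<nu> * cmod (y \<bullet>c c)"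
    using ys by linarith
  have s0: "0 \<le> s" by (simp add: s_def)
  note bound = four_thirds_bound[OF N z s0 norm_ge_zero norm_ge_zero st]
  show "N \<le> 4 / 3" by (rule bound(1))
  show "(cvec_norm (V *\<^sub>v u))\<^sup>2 = 1" if "N = 4 / 3"
    unfolding p using that by (rule bound(2))
qed

section \<open>Absolute values and the conclusion\<close>

lemma mat_abs_square:
  assumes "B \<in> carrier_mat n n"
  shows "mat_abs B \<in> carrier_mat n n" "mat_abs B * mat_abs B = mat_adjoint B * B"
  unfolding mat_abs_def
  using mult_carrier_mat[OF mat_adjoint_carrier[OF assms] assms] pos_semidef_adjoint_mult[OF assms]
  by (rule pos_sqrt_square)+

lemma mat_abs_power4_mult_vec:
  assumes B: "B \<in> carrier_mat n n" and x: "x \<in> carrier_vec n"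
  shows "(mat_abs B ^\<^sub>m 4) *\<^sub>v x = (mat_adjoint B * B) *\<^sub>v ((mat_adjoint B * B) *\<^sub>v x)"
proof -
  note R = mat_abs_square(1)[OF B]
  have "mat_abs B *\<^sub>v (mat_abs B *\<^sub>v y) = (mat_adjoint B * B) *\<^sub>v y" if "y \<in> carrier_vec n" for y
    using assoc_mult_mat_vec[OF R R that] mat_abs_square(2)[OF B] by simp
  moreover have "(mat_abs B ^\<^sub>m 4) *\<^sub>v x = mat_abs B *\<^sub>v (mat_abs B *\<^sub>v (mat_abs B *\<^sub>v (mat_abs B *\<^sub>v x)))"
    using R x by (simp add: numeral_eq_Suc assoc_mult_mat_vec[of _ n n _ n] mult_carrier_mat[of _ n n]
        del: assoc_mult_mat)
  moreover have "mat_abs B *\<^sub>v (mat_abs B *\<^sub>v x) \<in> carrier_vec n" using R x by simp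
  ultimately show ?thesis using x by simp
qed

text \<open>A positive semidefinite idempotent is its own positive square root.\<close>

lemma mat_abs_partial_isometry:
  assumes "V \<in> carrier_mat n n" "partial_isometry V"
  shows "mat_abs V = mat_adjoint V * V"
  using pos_sqrt_eqI[OF mult_carrier_mat[OF mat_adjoint_carrier[OF assms(1)] assms(1)]
      pos_semidef_adjoint_mult[OF assms(1)]]
  by (simp only: mat_abs_def partial_isometry_idempotent[OF assms])

theorem theorem1:
  fixes n :: nat and V Q :: "complex mat"
  assumes "n \<ge> 1"
    and "V \<in> carrier_mat n n" and "partial_isometry V"
    and "Q \<in> carrier_mat n n" and "orthogonal_projection Q" and "vec_space.rank n Q = 1"
  shows "mat_trace (Q * mat_abs (V - mat_trace (Q * V) \<cdot>\<^sub>m 1\<^sub>m n) ^\<^sub>m 4) \<le> 4 / 3 \<and>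
    (mat_trace (Q * mat_abs (V - mat_trace (Q * V) \<cdot>\<^sub>m 1\<^sub>m n) ^\<^sub>m 4) = 4 / 3
      \<longrightarrow> mat_abs V * Q = Q * mat_abs V)"
proof -
  note V = assms(2,3)
  obtain u where u: "u \<in> carrier_vec n" "cvec_norm u = 1" and Q: "Q = outer_square u"
    using rank_one_projection_eq_outer_square[OF assms(4-6)] by blast
  define B where "B = V - mat_trace (Q * V) \<cdot>\<^sub>m 1\<^sub>m n"
  have B_eq: "B = V - ((V *\<^sub>v u) \<bullet>c u) \<cdot>\<^sub>m 1\<^sub>m n"
    unfolding B_def Q mat_trace_outer_square_mult[OF V(1) u(1)] ..
  have B: "B \<in> carrier_mat n n" unfolding B_def by (rule minus_carrier_mat) simp
  define C where "C = mat_adjoint B * B"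
  have C: "C \<in> carrier_mat n n" unfolding C_def using B by auto
  have herm: "mat_adjoint C = C"
    unfolding C_def using pos_semidef_adjoint_mult[OF B] C[unfolded C_def] by (rule pos_semidef_mat_adjoint)
  define N where "N = (cvec_norm (mat_adjoint B *\<^sub>v (B *\<^sub>v u)))\<^sup>2"
  have "mat_trace (Q * mat_abs B ^\<^sub>m 4) = ((mat_abs B ^\<^sub>m 4) *\<^sub>v u) \<bullet>c u"
    unfolding Q using mat_abs_square(1)[OF B] u(1) by (intro mat_trace_outer_square_mult pow_carrier_mat)
  \<comment> \<open>The fourth power of \<open>mat_abs B\<close> is \<open>C\<close> applied twice;
    self-adjointness moves one factor across, leaving a squared norm.\<close>
  also have "\<dots> = (C *\<^sub>v u) \<bullet>c (C *\<^sub>v u)"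
    unfolding mat_abs_power4_mult_vec[OF B u(1)] C_def [symmetric]
    using C herm u(1) by (intro hermitian_cscalar_prod[of _ n]) auto
  also have "C *\<^sub>v u = mat_adjoint B *\<^sub>v (B *\<^sub>v u)"
    unfolding C_def using mat_adjoint_carrier[OF B] B u(1) by (rule assoc_mult_mat_vec)
  finally have trace: "mat_trace (Q * mat_abs B ^\<^sub>m 4) = of_real N"
    by (simp add: cscalar_prod_self N_def)
  note bound = contraction_fourth_moment[OF V(1) u, folded B_eq, folded N_def,
      OF partial_isometry_norm_le[OF V] partial_isometry_adjoint_norm_le[OF V]]
  have "mat_trace (Q * mat_abs B ^\<^sub>m 4) \<le> 4 / 3"
    using bound(1) by (simp add: trace less_eq_complex_def)
  moreover have "mat_abs V * Q = Q * mat_abs V" if "mat_trace (Q * mat_abs B ^\<^sub>m 4) = 4 / 3"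
  proof -
    define P where "P = mat_adjoint V * V"
    have P: "P \<in> carrier_mat n n" unfolding P_def using V by auto
    have hP: "mat_adjoint P = P"
      unfolding P_def using pos_semidef_adjoint_mult[OF V(1)] P[unfolded P_def] by (rule pos_semidef_mat_adjoint)
    have "N = 4 / 3" using that by (simp add: trace complex_eq_iff)
    then have "(cvec_norm (V *\<^sub>v u))\<^sup>2 = 1" using bound(2) by blast
    \<comment> \<open>Both norms in the defect formula are 1, so \<open>u\<close> is fixed by
      \<open>P\<close>.\<close>
    then have "cvec_norm (u - P *\<^sub>v u) = 0"
      using partial_isometry_defect[OF V u(1)] u(2) by (simp add: P_def)
    then have "u - P *\<^sub>v u = 0\<^sub>v n"
      using cvec_norm_eq_0_iff[of "u - P *\<^sub>v u" n] P u(1) by simp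
    then have "(u - P *\<^sub>v u) $ i = 0" if "i < n" for i using that by simp
    then have Pu: "P *\<^sub>v u = u" using P u(1) by (intro eq_vecI) auto
    have Qc: "Q \<in> carrier_mat n n" by fact
    \<comment> \<open>Both products send \<open>x\<close> to its projection onto the line of
      \<open>u\<close>: one because \<open>P\<close> fixes \<open>u\<close>, the other because
      \<open>P\<close> is also self-adjoint.\<close>
    have "P * Q = Q * P"
    proof (rule mat_eq_if_mult_vec_eq[of _ n n])
      fix x :: "complex vec" assume x: "x \<in> carrier_vec n"
      have "(P * Q) *\<^sub>v x = (x \<bullet>c u) \<cdot>\<^sub>v u"
        using assoc_mult_mat_vec[OF P Qc x] outer_square_mult_vec[OF u(1) x] mult_mat_vec[OF P u(1)] Pu
        by (simp add: Q)
      moreover have "(Q * P) *\<^sub>v x = (x \<bullet>c u) \<cdot>\<^sub>v u"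
        using assoc_mult_mat_vec[OF Qc P x] outer_square_mult_vec[OF u(1), of "P *\<^sub>v x"]
          hermitian_cscalar_prod[OF P hP x u(1)] Pu P x
        by (simp add: Q)
      ultimately show "(P * Q) *\<^sub>v x = (Q * P) *\<^sub>v x" by simp
    qed (use P Qc in auto)
    then show ?thesis using mat_abs_partial_isometry[OF V] by (simp add: P_def)
  qed
  ultimately show ?thesis unfolding B_def by blast
qed

end
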